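(* Fix $d\in\{1,2,3,7,11\}$. Let $p_1,q_1,p_2,q_2\in\mathbb{Z}[\omega_d]$ with $|p_1q_2-p_2q_1|<\frac{2\,\Im(\omega_d)}{|\omega_d|}$ and let a wall $X$ be given. If $X_1,X_2$ denote the two complementary components of $\mathbb{H}^3\setminus X$, then there is $i\in\{1,2\}$ such that the geodesic $\big(\frac{p_1}{q_1},\frac{p_2}{q_2}\big)$ is contained in the closure of $X_i$. Thus $\big(\frac{p_1}{q_1},\frac{p_2}{q_2}\big)$ cannot cross $X$.
   Context: $\omega_d=\sqrt{-d}$ for $d\in\{1,2\}$, $\omega_d=\frac{1+\sqrt{-d}}2$ for $d\in\{3,7,11\}$. $\mathbb{H}^3=\mathbb{C}\times\mathbb{R}_{>0}$ is hyperbolic upper half space; for $\alpha,\beta\in\mathbb{C}\cup\{\infty\}$ the geodesic $(\alpha,\beta)$ is the semicircle orthogonal to $\mathbb{C}$ joining $\alpha,\beta$ (a vertical half-line if one endpoint is $\infty$). Let $W_d\subset\mathbb{C}$ be the rectangle with corners $0,1,\omega_d,\omega_d+1$ if $d\in\{1,2\}$ and the triangle with corners $0,1,\omega_d$ if $d\in\{3,7,11\}$. A wall is the vertical half-plane $\{(z,t):z\in L,\ t>0\}$ (together with its boundary line) over the line $L\subset\mathbb{C}$ containing an edge of $W_d$. *)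

theory Defs
  imports "HOL-Analysis.Analysis" "HOL-Computational_Algebra.Polynomial"
begin

definition omega :: "nat \<Rightarrow> complex" where
  "omega d = (if d \<in> {1, 2} then csqrt (- of_nat d) else (1 + csqrt (- of_nat d)) / 2)"

definition Z_omega :: "nat \<Rightarrow> complex set" where
  "Z_omega d = range (\<lambda>f :: int poly. poly (map_poly of_int f) (omega d))"

definition hyp_space :: "(complex \<times> real) set" where
  "hyp_space = {(z, t). 0 < t}"

datatype ext_complex = Fin complex | Infty

text \<open>The value at \<open>q = 0\<close> is meaningful for \<open>p \<noteq> 0\<close> only; \<open>0/0\<close> is
  assigned \<open>Infty\<close> by convention.\<close>

definition ext_quot :: "complex \<Rightarrow> complex \<Rightarrow> ext_complex" where
  "ext_quot p q = (if q = 0 then Infty else Fin (p / q))"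

text \<open>The semicircle orthogonal to the boundary plane lies in the vertical plane over the
  line through \<open>a\<close> and \<open>b\<close>, and is centred at their midpoint. For equal endpoints, where
  there is no geodesic, the set is empty.\<close>

fun geodesic :: "ext_complex \<Rightarrow> ext_complex \<Rightarrow> (complex \<times> real) set" where
  "geodesic (Fin a) (Fin b) =
     {(z, t). 0 < t \<and> z \<in> affine hull {a, b} \<and>
        (cmod (z - (a + b) / 2))\<^sup>2 + t\<^sup>2 = (cmod (a - b) / 2)\<^sup>2}"
| "geodesic (Fin a) Infty = {(z, t). 0 < t \<and> z = a}"
| "geodesic Infty (Fin b) = {(z, t). 0 < t \<and> z = b}"
| "geodesic Infty Infty = {}"

definition W :: "nat \<Rightarrow> complex set" where
  "W d = (if d \<in> {1, 2} then convex hull {0, 1, omega d, omega d + 1}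
          else convex hull {0, 1, omega d})"

definition is_wall :: "nat \<Rightarrow> (complex \<times> real) set \<Rightarrow> bool" where
  "is_wall d X \<longleftrightarrow> (\<exists>E. E edge_of W d \<and> X = {(z, t). z \<in> affine hull E \<and> 0 \<le> t})"

definition crosses :: "(complex \<times> real) set \<Rightarrow> (complex \<times> real) set \<Rightarrow> bool" where
  "crosses G X \<longleftrightarrow>
     (\<exists>C\<in>components (hyp_space - X). \<exists>C'\<in>components (hyp_space - X).
        C \<noteq> C' \<and> G \<inter> C \<noteq> {} \<and> G \<inter> C' \<noteq> {})"

lemma wall_components:
  assumes "is_wall d X"
  shows "\<exists>n c. n \<noteq> 0 \<and>
           components (hyp_space - X) =
             {{(z, t). 0 < t \<and> n \<bullet> z < c}, {(z, t). 0 < t \<and> c < n \<bullet> z}} \<and>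
           {(z, t :: real). 0 < t \<and> n \<bullet> z < c} \<noteq> {(z, t). 0 < t \<and> c < n \<bullet> z}"
proof -
  obtain E where E: "E edge_of W d" "X = {(z, t). z \<in> affine hull E \<and> 0 \<le> t}"
    using assms unfolding is_wall_def by blast
  have "aff_dim E = DIM(complex) - 1"
    using E(1) by (simp add: edge_of_def)
  then obtain n c where n: "n \<noteq> 0" and hull: "affine hull E = {x. n \<bullet> x = c}"
    using aff_dim_eq_hyperplane[of E] by blast
  define A where "A = {(z::complex, t::real). 0 < t \<and> n \<bullet> z < c}"
  define B where "B = {(z::complex, t::real). 0 < t \<and> c < n \<bullet> z}"
  have A': "A = {z. n \<bullet> z < c} \<times> {0<..}" and B': "B = {z. n \<bullet> z > c} \<times> {0<..}"
    unfolding A_def B_def by auto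
  have diff: "hyp_space - X = A \<union> B"
    unfolding hyp_space_def E(2) hull A_def B_def by auto
  have opn: "open A" "open B"
    unfolding A' B' by (auto intro!: open_Times open_halfspace_lt open_halfspace_gt)
  have conn: "connected A" "connected B"
    unfolding A' B'
    by (auto intro!: convex_connected convex_Times convex_halfspace_lt convex_halfspace_gt)
  have nn: "n \<bullet> n \<noteq> 0" using n by simp
  have "(((c - 1) / (n \<bullet> n)) *\<^sub>R n, 1) \<in> A" "(((c + 1) / (n \<bullet> n)) *\<^sub>R n, 1) \<in> B"
    using nn by (auto simp: A_def B_def)
  hence ne: "A \<noteq> {}" "B \<noteq> {}" by auto
  have disj: "A \<inter> B = {}" unfolding A_def B_def by auto
  have max: "C = A \<or> C = B" if "C \<in> components (A \<union> B)" for C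
  proof -
    have C: "connected C" "C \<noteq> {}" "C \<subseteq> A \<union> B"
      using that in_components_connected in_components_nonempty in_components_subset by blast+
    have "C \<inter> A = {} \<or> C \<inter> B = {}"
      using connectedD[OF C(1) opn] C(3) disj by blast
    hence "C \<subseteq> A \<or> C \<subseteq> B" using C(3) by blast
    thus ?thesis
      using that conn ne unfolding in_components_maximal by blast
  qed
  have "A \<in> components (A \<union> B) \<and> B \<in> components (A \<union> B)"
  proof -
    have U: "\<Union>(components (A \<union> B)) = A \<union> B" by simp
    have "components (A \<union> B) \<subseteq> {A, B}" using max by blast
    thus ?thesis using U ne disj by blast
  qed
  hence "components (hyp_space - X) = {A, B}" unfolding diff using max by blast
  moreover have "A \<noteq> B" using ne disj by blast
  ultimately have "n \<noteq> 0 \<and> components (hyp_space - X) = {A, B} \<and> A \<noteq> B"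
    using n by simp
  thus ?thesis unfolding A_def B_def by (intro exI[of _ n] exI[of _ c])
qed

lemma Z_omega_eq:
  assumes "d \<in> {1, 2, 3, 7, 11}"
  shows "Z_omega d = {of_int a + of_int b * omega d | a b. True}"
proof -
  have "\<exists>r s :: int. (omega d)\<^sup>2 = of_int r + of_int s * omega d"
  proof (cases "d \<in> {1, 2}")
    case True
    hence "omega d = csqrt (- of_nat d)" by (simp only: omega_def if_True)
    hence "(omega d)\<^sup>2 = of_int (- int d) + of_int 0 * omega d"
      by (simp only: power2_csqrt) simp
    thus ?thesis by blast
  next
    case False
    let ?w = "csqrt (- of_nat d)"
    have w: "?w * ?w = - of_nat d" using power2_csqrt[of "- of_nat d"]
      by (simp only: power2_eq_square)
    have o: "omega d = (1 + ?w) / 2" using False by (simp only: omega_def if_False)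
    have "((1 + v) / 2)\<^sup>2 = (1 + v) / 2 - (1 - v * v) / 4" for v :: complex
      by (simp add: power2_eq_square field_simps)
    from this[of ?w] have "(omega d)\<^sup>2 = omega d - (1 + of_nat d) / 4"
      unfolding o w by simp
    moreover have "(1 + of_nat d) / 4 = (of_int ((1 + int d) div 4) :: complex)"
      using assms False by auto
    ultimately have "(omega d)\<^sup>2 = of_int (- ((1 + int d) div 4)) + of_int 1 * omega d"
      by simp
    thus ?thesis by blast
  qed
  then obtain r s :: int where rs: "(omega d)\<^sup>2 = of_int r + of_int s * omega d" by blast
  have "\<exists>a b :: int. poly (map_poly of_int f) (omega d) = of_int a + of_int b * omega d"
    for f :: "int poly"
  proof (induction f)
    case 0
    have "poly (map_poly of_int 0) (omega d) = of_int 0 + of_int 0 * omega d" by simp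
    thus ?case by blast
  next
    case (pCons k f)
    then obtain a b :: int
      where ab: "poly (map_poly of_int f) (omega d) = of_int a + of_int b * omega d" by blast
    have "poly (map_poly of_int (pCons k f)) (omega d)
            = of_int k + of_int a * omega d + of_int b * (omega d)\<^sup>2"
      using ab pCons.hyps by (simp add: map_poly_pCons algebra_simps power2_eq_square)
    also have "\<dots> = of_int (k + b * r) + of_int (a + b * s) * omega d"
      unfolding rs by (simp add: algebra_simps)
    finally show ?case by blast
  qed
  moreover have "of_int a + of_int b * omega d \<in> Z_omega d" for a b :: int
  proof -
    have "of_int a + of_int b * omega d = poly (map_poly of_int [:a, b:]) (omega d)"
      by (simp add: map_poly_pCons)
    thus ?thesis unfolding Z_omega_def by blast
  qed
  ultimately show ?thesis unfolding Z_omega_def by blast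
qed

end

theory Submission
  imports Defs
begin

text \<open>
  If the geodesic crosses the wall over a line \<open>L\<close>, its endpoints \<open>p\<^sub>1/q\<^sub>1\<close>, \<open>p\<^sub>2/q\<^sub>2\<close> are finite and
  lie strictly on opposite sides of \<open>L\<close>. Let \<open>L\<close> pass through the lattice point \<open>u\<close> with direction
  \<open>v \<in> \<int>[\<omega>]\<close>. The distance of \<open>p/q\<close> to \<open>L\<close> is \<open>|Im ((p - uq) cnj q cnj v)| / (|v| |q|\<^sup>2)\<close>, and the
  imaginary part of an element of \<open>\<int>[\<omega>]\<close> is an integer multiple of \<open>Im \<omega>\<close>, so a nonzero distance is
  at least \<open>Im \<omega> / (|v| |q|\<^sup>2)\<close>. Adding the two distances and using AM-GM gives
  \<open>|p\<^sub>1q\<^sub>2 - p\<^sub>2q\<^sub>1| = |q\<^sub>1q\<^sub>2| |p\<^sub>1/q\<^sub>1 - p\<^sub>2/q\<^sub>2| \<ge> 2 Im \<omega> / |v|\<close>, and \<open>|v| \<le> |\<omega>|\<close> for the edges of \<open>W\<^sub>d\<close>.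
\<close>

section \<open>Real part, imaginary part and size of \<open>omega d\<close>\<close>

lemma csqrt_minus_of_nat: "csqrt (- of_nat d) = \<i> * of_real (sqrt (real d))"
  using csqrt_of_real_nonpos[of "- real d"] by simp

lemma omega_rectangle:
  assumes "d \<in> {1, 2}"
  shows "Re (omega d) = 0" "Im (omega d) = sqrt (real d)"
proof -
  have "omega d = \<i> * of_real (sqrt (real d))"
    unfolding omega_def csqrt_minus_of_nat by (simp only: assms if_True)
  thus "Re (omega d) = 0" "Im (omega d) = sqrt (real d)" by simp_all
qed

lemma omega_triangle:
  assumes "d \<notin> {1, 2}"
  shows "Re (omega d) = 1 / 2" "Im (omega d) = sqrt (real d) / 2"
proof -
  have w: "omega d = (1 + \<i> * of_real (sqrt (real d))) / 2"
    unfolding omega_def csqrt_minus_of_nat by (simp only: assms if_False)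
  show "Re (omega d) = 1 / 2" "Im (omega d) = sqrt (real d) / 2" unfolding w by simp_all
qed

lemma Im_omega_pos:
  assumes "0 < d"
  shows "0 < Im (omega d)"
proof (cases "d \<in> {1, 2}")
  case True
  show ?thesis unfolding omega_rectangle(2)[OF True] using assms by simp
next
  case False
  show ?thesis unfolding omega_triangle(2)[OF False] using assms by simp
qed

text \<open>Makes \<open>cmod (omega d)\<close> a common upper bound for the edge lengths of
  \<open>W d\<close>, since some edges have length 1.\<close>

lemma cmod_omega_ge_1:
  assumes "d \<in> {1, 2, 3, 7, 11}"
  shows "1 \<le> cmod (omega d)"
proof -
  have "1 \<le> (Re (omega d))\<^sup>2 + (Im (omega d))\<^sup>2"
  proof (cases "d \<in> {1, 2}")
    case True
    show ?thesis unfolding omega_rectangle[OF True] using assms by auto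
  next
    case False
    show ?thesis unfolding omega_triangle[OF False]
      using assms False by (auto simp: power_divide)
  qed
  thus ?thesis by (simp add: cmod_def)
qed

section \<open>Ring operations and conjugation in \<open>Z_omega d\<close>\<close>

lemma Z_omega_of_int:
  assumes "d \<in> {1, 2, 3, 7, 11}"
  shows "of_int a + of_int b * omega d \<in> Z_omega d"
  unfolding Z_omega_eq[OF assms] by blast

lemma Z_omega_basic:
  assumes "d \<in> {1, 2, 3, 7, 11}"
  shows "0 \<in> Z_omega d" "1 \<in> Z_omega d" "omega d \<in> Z_omega d"
  using Z_omega_of_int[OF assms, of 0 0] Z_omega_of_int[OF assms, of 1 0]
    Z_omega_of_int[OF assms, of 0 1] by simp_all

lemma Z_omega_diff:
  assumes d: "d \<in> {1, 2, 3, 7, 11}" and "x \<in> Z_omega d" "y \<in> Z_omega d"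
  shows "x - y \<in> Z_omega d"
proof -
  obtain a b a' b' where "x = of_int a + of_int b * omega d" "y = of_int a' + of_int b' * omega d"
    using assms unfolding Z_omega_eq[OF d] by blast
  hence "x - y = of_int (a - a') + of_int (b - b') * omega d"
    by (simp add: algebra_simps)
  thus ?thesis using Z_omega_of_int[OF d] by metis
qed

lemma Z_omega_add:
  assumes d: "d \<in> {1, 2, 3, 7, 11}" and "x \<in> Z_omega d" "y \<in> Z_omega d"
  shows "x + y \<in> Z_omega d"
  using Z_omega_diff[OF d assms(2) Z_omega_diff[OF d Z_omega_basic(1)[OF d] assms(3)]] by simp

lemma Z_omega_mult:
  assumes d: "d \<in> {1, 2, 3, 7, 11}" and "x \<in> Z_omega d" "y \<in> Z_omega d"
  shows "x * y \<in> Z_omega d"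
proof -
  obtain a b a' b' where xy: "x = of_int a + of_int b * omega d"
      "y = of_int a' + of_int b' * omega d"
    using assms unfolding Z_omega_eq[OF d] by blast
  \<comment> \<open>The polynomial definition puts the square of \<open>omega d\<close> in the ring
    at once; the basis form then supplies its quadratic relation.\<close>
  have "omega d * omega d = poly (map_poly of_int [:0, 0, 1:]) (omega d)"
    by (simp add: map_poly_pCons)
  hence "omega d * omega d \<in> Z_omega d" unfolding Z_omega_def by blast
  then obtain r s where rs: "omega d * omega d = of_int r + of_int s * omega d"
    unfolding Z_omega_eq[OF d] by blast
  have "x * y = of_int (a * a') + of_int (a * b' + a' * b) * omega d
      + of_int (b * b') * (omega d * omega d)"
    unfolding xy by (simp add: algebra_simps)
  also have "\<dots> = of_int (a * a' + b * b' * r) + of_int (a * b' + a' * b + b * b' * s) * omega d"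
    unfolding rs by (simp add: algebra_simps)
  finally show ?thesis using Z_omega_of_int[OF d] by metis
qed

text \<open>The trace \<open>2 * Re (omega d)\<close> is 0 or 1, so the conjugate of
  \<open>omega d\<close> is an integer minus \<open>omega d\<close>.\<close>

lemma Z_omega_cnj:
  assumes d: "d \<in> {1, 2, 3, 7, 11}" and "x \<in> Z_omega d"
  shows "cnj x \<in> Z_omega d"
proof -
  obtain a b where x: "x = of_int a + of_int b * omega d"
    using assms unfolding Z_omega_eq[OF d] by blast
  obtain k :: int where "2 * Re (omega d) = of_int k"
  proof (cases "d \<in> {1, 2}")
    case True
    with that[of 0] show ?thesis by (simp add: omega_rectangle(1))
  next
    case False
    with that[of 1] show ?thesis by (simp add: omega_triangle(1))
  qed
  hence "cnj (omega d) = of_int k - omega d"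
    by (simp add: complex_eq_iff)
  hence "cnj x = of_int a + of_int b * (of_int k - omega d)" unfolding x by simp
  also have "\<dots> = of_int (a + b * k) + of_int (- b) * omega d" by (simp add: algebra_simps)
  finally have "cnj x = of_int (a + b * k) + of_int (- b) * omega d" .
  thus ?thesis using Z_omega_of_int[OF d] by metis
qed

section \<open>How close a quotient can come to a lattice line\<close>

lemma Im_Z_omega_ge:
  assumes d: "d \<in> {1, 2, 3, 7, 11}" and "x \<in> Z_omega d" "Im x \<noteq> 0"
  shows "Im (omega d) \<le> \<bar>Im x\<bar>"
proof -
  obtain a b where x: "x = of_int a + of_int b * omega d"
    using assms unfolding Z_omega_eq[OF d] by blast
  have pos: "0 < Im (omega d)" using d by (intro Im_omega_pos) auto
  have "b \<noteq> 0" using assms(3) x by auto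
  hence "1 \<le> \<bar>real_of_int b\<bar>" by linarith
  hence "1 * Im (omega d) \<le> \<bar>real_of_int b\<bar> * Im (omega d)"
    using pos by (intro mult_right_mono) auto
  thus ?thesis using pos x by (simp add: abs_mult)
qed

text \<open>\<open>Im (w * cnj v)\<close> is the inner product of \<open>w\<close> with
  \<open>\<i> * v\<close>, and for nonzero \<open>v\<close> the normal \<open>n\<close> is a real
  multiple of \<open>\<i> * v\<close>. Squaring turns the claim into a polynomial consequence of
  orthogonality, which also covers \<open>v = 0\<close>.\<close>

lemma abs_inner_orthogonal:
  fixes n v w :: complex
  assumes "n \<bullet> v = 0"
  shows "\<bar>n \<bullet> w\<bar> * cmod v = cmod n * \<bar>Im (w * cnj v)\<bar>"
proof -
  define a b where "a = n \<bullet> w" and "b = Im (w * cnj v)"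
  have "Re n * Re v + Im n * Im v = 0" using assms by (simp add: inner_complex_def)
  hence "a\<^sup>2 * ((Re v)\<^sup>2 + (Im v)\<^sup>2) = ((Re n)\<^sup>2 + (Im n)\<^sup>2) * b\<^sup>2"
    unfolding a_def b_def inner_complex_def by simp algebra
  hence "(\<bar>a\<bar> * cmod v)\<^sup>2 = (cmod n * \<bar>b\<bar>)\<^sup>2"
    by (simp add: power_mult_distrib cmod_power2)
  hence "\<bar>a\<bar> * cmod v = cmod n * \<bar>b\<bar>"
    by (subst (asm) power2_eq_iff_nonneg) auto
  thus ?thesis by (simp add: a_def b_def)
qed

text \<open>The normal \<open>n\<close> is not normalised: the distance of a point \<open>z\<close>
  to the line is \<open>\<bar>n \<bullet> z - c\<bar> / cmod n\<close>, hence the factor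
  \<open>cmod n\<close>.\<close>

lemma quotient_distance_to_line:
  assumes d: "d \<in> {1, 2, 3, 7, 11}"
    and Z: "p \<in> Z_omega d" "q \<in> Z_omega d" "u \<in> Z_omega d" "v \<in> Z_omega d"
    and "q \<noteq> 0" "v \<noteq> 0" "n \<noteq> 0" "n \<bullet> v = 0" "n \<bullet> u = c" "n \<bullet> (p / q) \<noteq> c"
  shows "cmod n * Im (omega d) \<le> \<bar>n \<bullet> (p / q) - c\<bar> * cmod v * (cmod q)\<^sup>2"
proof -
  define w where "w = p / q - u"
  \<comment> \<open>Multiplying \<open>w * cnj v\<close> by \<open>q * cnj q\<close> clears the
    denominator and scales the imaginary part only by a positive real; in this form \<open>y\<close>
    visibly lies in the ring.\<close>
  define y where "y = (p - u * q) * cnj q * cnj v"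
  have "n \<bullet> w = n \<bullet> (p / q) - c" using assms by (simp add: w_def inner_diff_right)
  hence dist: "\<bar>n \<bullet> (p / q) - c\<bar> * cmod v = cmod n * \<bar>Im (w * cnj v)\<bar>"
    using abs_inner_orthogonal[OF \<open>n \<bullet> v = 0\<close>, of w] by simp
  have "y = (w * cnj v) * (q * cnj q)"
    using \<open>q \<noteq> 0\<close> by (simp add: y_def w_def field_simps)
  also have "\<dots> = of_real ((cmod q)\<^sup>2) * (w * cnj v)"
    by (simp only: complex_norm_square mult.commute)
  finally have Imy: "Im y = (cmod q)\<^sup>2 * Im (w * cnj v)"
    by (simp only: Im_complex_of_real Re_complex_of_real times_complex.sel)
  have "Im (w * cnj v) \<noteq> 0" using dist assms by auto
  hence "Im y \<noteq> 0" using Imy \<open>q \<noteq> 0\<close> by simp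
  moreover have "y \<in> Z_omega d" unfolding y_def
    by (intro Z_omega_mult Z_omega_diff Z_omega_cnj d Z)
  ultimately have "Im (omega d) \<le> \<bar>Im y\<bar>" by (intro Im_Z_omega_ge d)
  hence "cmod n * Im (omega d) \<le> cmod n * \<bar>Im y\<bar>" by (intro mult_left_mono) auto
  also have "\<dots> = (\<bar>n \<bullet> (p / q) - c\<bar> * cmod v) * (cmod q)\<^sup>2"
    unfolding dist Imy by (simp add: abs_mult)
  finally show ?thesis .
qed

lemma separated_quotients_det_ge:
  assumes d: "d \<in> {1, 2, 3, 7, 11}"
    and Z: "p1 \<in> Z_omega d" "q1 \<in> Z_omega d" "p2 \<in> Z_omega d" "q2 \<in> Z_omega d"
      "u \<in> Z_omega d" "v \<in> Z_omega d"
    and nz: "q1 \<noteq> 0" "q2 \<noteq> 0" "v \<noteq> 0" "n \<noteq> 0"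
    and L: "n \<bullet> v = 0" "n \<bullet> u = c"
    and sep: "n \<bullet> (p1 / q1) < c" "c < n \<bullet> (p2 / q2)"
  shows "2 * Im (omega d) / cmod v \<le> cmod (p1 * q2 - p2 * q1)"
proof -
  define a b V N D I where "a = cmod q1" and "b = cmod q2" and "V = cmod v" and "N = cmod n"
    and "D = cmod (p1 / q1 - p2 / q2)" and "I = Im (omega d)"
  define x y where "x = c - n \<bullet> (p1 / q1)" and "y = n \<bullet> (p2 / q2) - c"
  have pos: "0 < a" "0 < b" "0 < V" "0 < N" "0 < I" using nz d
    by (auto simp: a_def b_def V_def N_def I_def intro: Im_omega_pos)
  have "N * I \<le> \<bar>n \<bullet> (p1 / q1) - c\<bar> * V * a\<^sup>2" "N * I \<le> \<bar>n \<bullet> (p2 / q2) - c\<bar> * V * b\<^sup>2"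
    unfolding N_def I_def V_def a_def b_def
    using sep by (intro quotient_distance_to_line[where u = u] d Z nz L; simp)+
  hence "N * I \<le> x * V * a\<^sup>2" "N * I \<le> y * V * b\<^sup>2"
    using sep by (simp_all add: x_def y_def)
  hence "N * I / (V * a\<^sup>2) \<le> x" "N * I / (V * b\<^sup>2) \<le> y"
    using pos by (simp_all add: field_simps)
  \<comment> \<open>Both \<open>x\<close> and \<open>y\<close> are positive because the quotients
    lie on opposite sides, so their sum is the separation in direction \<open>n\<close>, bounded by
    Cauchy-Schwarz.\<close>
  moreover have "x + y \<le> N * D"
  proof -
    have "x + y = n \<bullet> (p2 / q2 - p1 / q1)" by (simp add: x_def y_def inner_diff_right)
    also have "\<dots> \<le> N * D"
      unfolding N_def D_def by (metis norm_cauchy_schwarz norm_minus_commute)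
    finally show ?thesis .
  qed
  ultimately have "N * I / (V * a\<^sup>2) + N * I / (V * b\<^sup>2) \<le> N * D" by linarith
  hence "N * (I / V * (1 / a\<^sup>2 + 1 / b\<^sup>2)) \<le> N * D" by (simp add: distrib_left)
  hence "I / V * (1 / a\<^sup>2 + 1 / b\<^sup>2) \<le> D" using pos by (simp only: mult_le_cancel_left_pos)
  \<comment> \<open>AM-GM for \<open>1 / a\<close> and \<open>1 / b\<close>; the product
    \<open>a * b\<close> is what turns \<open>D\<close> into the determinant.\<close>
  moreover have "2 / (a * b) \<le> 1 / a\<^sup>2 + 1 / b\<^sup>2"
    using sum_squares_bound[of "1 / a" "1 / b"] by (simp add: power_divide)
  hence "I / V * (2 / (a * b)) \<le> I / V * (1 / a\<^sup>2 + 1 / b\<^sup>2)"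
    using pos by (intro mult_left_mono) auto
  ultimately have "I / V * (2 / (a * b)) \<le> D" by linarith
  hence "2 * I / V \<le> D * (a * b)" using pos by (simp add: field_simps)
  also have "D * (a * b) = cmod ((p1 / q1 - p2 / q2) * (q1 * q2))"
    by (simp add: D_def a_def b_def norm_mult)
  also have "(p1 / q1 - p2 / q2) * (q1 * q2) = p1 * q2 - p2 * q1"
    using nz by (simp add: field_simps)
  finally show ?thesis by (simp add: I_def V_def)
qed

section \<open>Edges of \<open>W d\<close> and their direction vectors\<close>

lemma edge_of_convex_hull_two_vertices:
  fixes S :: "complex set"
  assumes "finite S" "E edge_of convex hull S"
  obtains x y where "x \<in> S" "y \<in> S" "x \<noteq> y" "x \<in> E" "y \<in> E"
proof -
  have E: "E face_of convex hull S" "aff_dim E = 1"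
    using assms(2) by (auto simp: edge_of_def)
  \<comment> \<open>A face of the hull of a finite set is spanned by some of its points; dimension 1
    forces at least two of them.\<close>
  then obtain T where T: "T \<subseteq> S" "E = convex hull T"
    using face_of_convex_hull_subset assms(1) finite_imp_compact by metis
  have "aff_dim T = 1" using E T aff_dim_convex_hull by metis
  hence "T \<noteq> {}" "\<And>x. T \<noteq> {x}" by auto
  then obtain x y where "x \<in> T" "y \<in> T" "x \<noteq> y" by blast
  moreover have "T \<subseteq> E" using T by (simp add: hull_subset)
  ultimately show ?thesis using that T(1) by blast
qed

text \<open>Two corners on the edge give \<open>u\<close> and \<open>u + v\<close>. Only a diagonal
  of the rectangle could make \<open>v\<close> too long, and no edge contains one.\<close>

lemma edge_of_W_direction:
  assumes d: "d \<in> {1, 2, 3, 7, 11}" and E: "E edge_of W d"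
  shows "\<exists>u v. u \<in> Z_omega d \<and> v \<in> Z_omega d \<and> v \<noteq> 0 \<and> cmod v \<le> cmod (omega d) \<and>
    u \<in> E \<and> u + v \<in> E"
proof -
  let ?w = "omega d"
  have Z: "0 \<in> Z_omega d" "1 \<in> Z_omega d" "?w \<in> Z_omega d" "?w + 1 \<in> Z_omega d"
    using Z_omega_basic[OF d] Z_omega_add[OF d] by auto
  have ge: "1 \<le> cmod ?w" using cmod_omega_ge_1[OF d] .
  have pair: ?thesis if "x \<in> E" "y \<in> E" "x \<in> Z_omega d" "y \<in> Z_omega d" "x \<noteq> y"
    "cmod (y - x) \<le> cmod ?w" for x y
    using that Z_omega_diff[OF d] by (intro exI[of _ x] exI[of _ "y - x"]) auto
  show ?thesis
  proof (cases "d \<in> {1, 2}")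
    case True
    let ?S = "{0, 1, ?w, ?w + 1}"
    have W: "W d = convex hull ?S" using True by (simp only: W_def if_True)
    obtain x y where xy: "x \<in> ?S" "y \<in> ?S" "x \<noteq> y" "x \<in> E" "y \<in> E"
      using edge_of_convex_hull_two_vertices[of ?S E] E W by auto
    show ?thesis
    \<comment> \<open>Among pairs of distinct corners, exactly the two diagonals have this sum; all
      other differences are 1 or \<open>?w\<close> up to sign.\<close>
    proof (cases "x + y = ?w + 1")
      case True
      \<comment> \<open>A face containing a diagonal contains the centre of the rectangle, hence all vertices.\<close>
      have face: "E face_of W d" using E by (simp add: edge_of_def)
      have m: "midpoint x y \<in> E"
        using face_of_imp_convex[OF face] xy
        by (metis convex_contains_segment midpoint_in_closed_segment subsetD)
      have "midpoint x y = midpoint 0 (?w + 1)" "midpoint x y = midpoint 1 ?w"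
        using True by (simp_all add: midpoint_def add.commute)
      moreover have "?w \<noteq> 1" "?w + 1 \<noteq> 0"
        using Im_omega_pos[of d] d by (auto simp: complex_eq_iff)
      ultimately have "midpoint x y \<in> open_segment 0 (?w + 1)" "midpoint x y \<in> open_segment 1 ?w"
        by (metis midpoint_in_open_segment)+
      moreover have "?S \<subseteq> W d" unfolding W by (rule hull_subset)
      ultimately have "0 \<in> E" "1 \<in> E" using face_ofD[OF face _ _ _ m] by blast+
      thus ?thesis using pair[of 0 1] Z ge by simp
    next
      case False
      hence "cmod (y - x) = 1 \<or> cmod (y - x) = cmod ?w" using xy(1-3)
        by (auto simp: norm_minus_commute add.commute)
      thus ?thesis using pair[of x y] xy Z ge by auto
    qed
  next
    case False
    let ?S = "{0, 1, ?w}"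
    have W: "W d = convex hull ?S" using False by (simp only: W_def if_False)
    obtain x y where xy: "x \<in> ?S" "y \<in> ?S" "x \<noteq> y" "x \<in> E" "y \<in> E"
      using edge_of_convex_hull_two_vertices[of ?S E] E W by auto
    \<comment> \<open>The triangle is isosceles, as \<open>omega d\<close> has real part
      1/2.\<close>
    have w1: "cmod (?w - 1) = cmod ?w"
      by (simp add: cmod_def omega_triangle(1)[OF False] power2_eq_square)
    hence "cmod (1 - ?w) = cmod ?w" by (simp add: norm_minus_commute)
    hence "cmod (y - x) = 1 \<or> cmod (y - x) = cmod ?w" using xy(1-3) w1 by auto
    thus ?thesis using pair[of x y] xy Z ge by auto
  qed
qed

section \<open>Geodesics and half-spaces\<close>

lemma geodesic_Fin_subset_segment:
  assumes "(z, t) \<in> geodesic (Fin a) (Fin b)"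
  shows "z \<in> closed_segment a b"
proof -
  have "z \<in> affine hull {a, b}"
    and eq: "(cmod (z - (a + b) / 2))\<^sup>2 + t\<^sup>2 = (cmod (a - b) / 2)\<^sup>2"
    using assms by auto
  then obtain r s where rs: "z = r *\<^sub>R a + s *\<^sub>R b" "r + s = 1"
    unfolding affine_hull_2 by auto
  have z: "z = (1 - s) *\<^sub>R a + s *\<^sub>R b" using rs by (simp add: eq_diff_eq[symmetric])
  \<comment> \<open>Dropping the height term puts \<open>z\<close> within half the endpoint distance
    of the midpoint; on the line this bounds \<open>s\<close> between 0 and 1.\<close>
  have "(cmod (z - (a + b) / 2))\<^sup>2 \<le> (cmod (a - b) / 2)\<^sup>2"
    unfolding eq[symmetric] by simp
  hence le: "cmod (z - (a + b) / 2) \<le> cmod (a - b) / 2"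
    by (rule power2_le_imp_le) simp
  have "z - (a + b) / 2 = (1 / 2 - s) *\<^sub>R (a - b)"
    unfolding z by (simp add: scaleR_conv_of_real field_simps)
  hence le': "\<bar>1 / 2 - s\<bar> * cmod (a - b) \<le> 1 / 2 * cmod (a - b)" using le by simp
  show ?thesis
  proof (cases "a = b")
    case True
    thus ?thesis using z by (simp add: algebra_simps)
  next
    case False
    hence "\<bar>1 / 2 - s\<bar> \<le> 1 / 2" using le' by (simp add: mult_le_cancel_right)
    hence "0 \<le> s" "s \<le> 1" by linarith+
    thus ?thesis using z unfolding closed_segment_def by blast
  qed
qed

lemma geodesic_Fin_halfspace_le:
  assumes "n \<bullet> a \<le> c" "n \<bullet> b \<le> c" "(z, t) \<in> geodesic (Fin a) (Fin b)"
  shows "n \<bullet> z \<le> c"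
  using geodesic_Fin_subset_segment[OF assms(3)] assms(1,2)
    closed_segment_subset[of a "{x. n \<bullet> x \<le> c}" b] convex_halfspace_le[of n c] by auto

text \<open>With an endpoint \<open>Infty\<close> the geodesic is empty or has constant
  \<open>z\<close>, so one-sidedness is automatic and only two finite endpoints need a
  hypothesis.\<close>

lemma geodesic_one_sided:
  assumes "\<And>a b. \<alpha> = Fin a \<Longrightarrow> \<beta> = Fin b \<Longrightarrow>
      \<not> (n \<bullet> a < c \<and> c < n \<bullet> b) \<and> \<not> (n \<bullet> b < c \<and> c < n \<bullet> a)"
  shows "(\<forall>(z, t) \<in> geodesic \<alpha> \<beta>. n \<bullet> z \<le> c) \<or> (\<forall>(z, t) \<in> geodesic \<alpha> \<beta>. c \<le> n \<bullet> z)"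
proof (cases "\<exists>a b. \<alpha> = Fin a \<and> \<beta> = Fin b")
  case True
  then obtain a b where ab: "\<alpha> = Fin a" "\<beta> = Fin b" by blast
  hence "n \<bullet> a \<le> c \<and> n \<bullet> b \<le> c \<or> c \<le> n \<bullet> a \<and> c \<le> n \<bullet> b" using assms by force
  thus ?thesis
  proof
    assume "n \<bullet> a \<le> c \<and> n \<bullet> b \<le> c"
    thus ?thesis unfolding ab using geodesic_Fin_halfspace_le[of n a c b] by blast
  next
    assume "c \<le> n \<bullet> a \<and> c \<le> n \<bullet> b"
    hence "c \<le> n \<bullet> z" if "(z, t) \<in> geodesic (Fin a) (Fin b)" for z t
      using geodesic_Fin_halfspace_le[of "- n" a "- c" b z t] that by simp
    thus ?thesis unfolding ab by blast
  qed
next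
  case False
  thus ?thesis by (cases \<alpha>; cases \<beta>) auto
qed

text \<open>Admits geodesics that touch or lie in the wall. For \<open>n = 0\<close>,
  \<open>c = 0\<close> the open sides would be empty, so \<open>n \<noteq> 0\<close>
  matters.\<close>

lemma closure_halfspace_Times:
  fixes n :: complex
  assumes "n \<noteq> 0"
  shows "{(z, t :: real). 0 < t \<and> n \<bullet> z \<le> c} \<subseteq> closure {(z, t). 0 < t \<and> n \<bullet> z < c}"
    and "{(z, t :: real). 0 < t \<and> c \<le> n \<bullet> z} \<subseteq> closure {(z, t). 0 < t \<and> c < n \<bullet> z}"
proof -
  have "{(z, t :: real). 0 < t \<and> n \<bullet> z < c} = {z. n \<bullet> z < c} \<times> {0<..}"
    "{(z, t :: real). 0 < t \<and> c < n \<bullet> z} = {z. n \<bullet> z > c} \<times> {0<..}" by auto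
  thus "{(z, t :: real). 0 < t \<and> n \<bullet> z \<le> c} \<subseteq> closure {(z, t). 0 < t \<and> n \<bullet> z < c}"
    "{(z, t :: real). 0 < t \<and> c \<le> n \<bullet> z} \<subseteq> closure {(z, t). 0 < t \<and> c < n \<bullet> z}"
    using assms by (auto simp: closure_Times)
qed

lemma geodesic_subset_hyp_space: "geodesic \<alpha> \<beta> \<subseteq> hyp_space"
  by (cases \<alpha>; cases \<beta>) (auto simp: hyp_space_def)

theorem theorem2:
  fixes d :: nat
    and p1 q1 p2 q2 :: complex
    and X X1 X2 :: "(complex \<times> real) set"
  assumes "d \<in> {1, 2, 3, 7, 11}"
    and "p1 \<in> Z_omega d" "q1 \<in> Z_omega d" "p2 \<in> Z_omega d" "q2 \<in> Z_omega d"
    and "cmod (p1 * q2 - p2 * q1) < 2 * Im (omega d) / cmod (omega d)"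
    and "is_wall d X"
    and "components (hyp_space - X) = {X1, X2}" "X1 \<noteq> X2"
  shows "(geodesic (ext_quot p1 q1) (ext_quot p2 q2) \<subseteq> closure X1 \<or>
          geodesic (ext_quot p1 q1) (ext_quot p2 q2) \<subseteq> closure X2) \<and>
         \<not> crosses (geodesic (ext_quot p1 q1) (ext_quot p2 q2)) X"
proof -
  let ?G = "geodesic (ext_quot p1 q1) (ext_quot p2 q2)"
  note d = assms(1)
  obtain n c where n: "n \<noteq> 0" and comp: "components (hyp_space - X) =
      {{(z, t). 0 < t \<and> n \<bullet> z < c}, {(z, t). 0 < t \<and> c < n \<bullet> z}}"
    using wall_components[OF assms(7)] by blast
  obtain E where E: "E edge_of W d" "X = {(z, t). z \<in> affine hull E \<and> 0 \<le> t}"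
    using assms(7) unfolding is_wall_def by blast
  \<comment> \<open>\<open>n\<close> and \<open>c\<close> are known only through the two components.
    A point of the wall avoids both, so both strict inequalities fail.\<close>
  have on_line: "n \<bullet> z = c" if "z \<in> E" for z
  proof -
    have "(z, 1) \<in> X" using that E(2) by (auto intro: hull_inc)
    hence "(z, 1) \<notin> \<Union>(components (hyp_space - X))" by simp
    thus ?thesis unfolding comp by auto
  qed
  obtain u v where u: "u \<in> Z_omega d" and v: "v \<in> Z_omega d" "v \<noteq> 0"
    and le: "cmod v \<le> cmod (omega d)" and "u \<in> E" "u + v \<in> E"
    using edge_of_W_direction[OF d E(1)] by blast
  hence L: "n \<bullet> v = 0" "n \<bullet> u = c"
    using on_line[of u] on_line[of "u + v"] by (simp_all add: inner_add_right)
  have "2 * Im (omega d) / cmod (omega d) \<le> 2 * Im (omega d) / cmod v"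
  proof (rule divide_left_mono[OF le])
    show "0 \<le> 2 * Im (omega d)" using Im_omega_pos[of d] d by auto
    show "0 < cmod (omega d) * cmod v"
      using v cmod_omega_ge_1[OF d] by (intro mult_pos_pos) auto
  qed
  hence small: "cmod (p1 * q2 - p2 * q1) < 2 * Im (omega d) / cmod v"
    using assms(6) by linarith
  \<comment> \<open>The second configuration exchanges the two quotients, which only changes the
    sign of the determinant.\<close>
  have "\<not> (n \<bullet> (p1 / q1) < c \<and> c < n \<bullet> (p2 / q2)) \<and> \<not> (n \<bullet> (p2 / q2) < c \<and> c < n \<bullet> (p1 / q1))"
    if "q1 \<noteq> 0" "q2 \<noteq> 0"
    using separated_quotients_det_ge[OF d assms(2-5) u v(1) that v(2) n L]
      separated_quotients_det_ge[OF d assms(4,5,2,3) u v(1) that(2,1) v(2) n L]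
      small norm_minus_commute[of "p1 * q2" "p2 * q1"] by force
  hence "(\<forall>(z, t) \<in> ?G. n \<bullet> z \<le> c) \<or> (\<forall>(z, t) \<in> ?G. c \<le> n \<bullet> z)"
    by (intro geodesic_one_sided) (auto simp: ext_quot_def split: if_splits)
  hence side: "?G \<subseteq> {(z, t). 0 < t \<and> n \<bullet> z \<le> c} \<or> ?G \<subseteq> {(z, t). 0 < t \<and> c \<le> n \<bullet> z}"
    using geodesic_subset_hyp_space[of "ext_quot p1 q1" "ext_quot p2 q2"]
    unfolding hyp_space_def by blast
  have "\<exists>C \<in> components (hyp_space - X). ?G \<subseteq> closure C"
    using side closure_halfspace_Times[OF n, of c] unfolding comp by blast
  \<comment> \<open>The components are the strict sides, and a one-sided geodesic misses one of
    them.\<close>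
  moreover have "\<not> crosses ?G X"
    using side unfolding crosses_def comp by fastforce
  ultimately show ?thesis unfolding assms(8) by blast
qed

end
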